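(* Let $\alpha\in(-1,0)$, let $1\le p\le\infty$, and let $f=\mathcal{P}_\alpha[F]$, where $F:\mathbb{U}\to\mathbb{C}$ is absolutely continuous with $\dot F\in L^p(\mathbb{U})$. Then ($\overline{\partial}f\in\mathcal{H}^p_{\mathcal{G}}(\mathbb{D})$ or $\partial f\in\mathcal{H}^p_{\mathcal{G}}(\mathbb{D})$) if and only if $f$ is analytic in $\mathbb{D}$.
   Context: $\mathbb{D}$ is the open unit disk in $\mathbb{C}$ and $\mathbb{U}=\partial\mathbb{D}$ the unit circle. For $z=x+iy$, $\partial f=f_z=\frac12(f_x-if_y)$ and $\overline{\partial}f=f_{\bar z}=\frac12(f_x+if_y)$. For $\alpha>-1$, the $\alpha$-harmonic Poisson kernel is $P_\alpha(z)=\frac{(1-|z|^2)^{\alpha+1}}{(1-z)(1-\bar z)^{\alpha+1}}$ (principal branch of the power), and $\mathcal{P}_\alpha[F](z)=\frac1{2\pi}\int_0^{2\pi}P_\alpha(ze^{-i\theta})F(e^{i\theta})\,d\theta$, $z\in\mathbb{D}$. $F$ absolutely continuous on $\mathbb{U}$ means that $\theta\mapsto F(e^{i\theta})$ is absolutely continuous on $[0,2\pi]$; then $\dot F(e^{i\theta})=\frac{d}{d\theta}F(e^{i\theta})$ exists for almost every $\theta$. $L^p(\mathbb{U})$ is the usual Lebesgue space on the circle (with respect to $d\theta/2\pi$; essentially bounded functions for $p=\infty$). For $p\in(0,\infty]$, the generalized Hardy space $\mathcal{H}^p_{\mathcal{G}}(\mathbb{D})$ consists of all measurable $f:\mathbb{D}\to\mathbb{C}$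 such that $M_p(r,f)$ exists for all $r\in(0,1)$ and $\|f\|_p<\infty$, where for $p<\infty$, $M_p(r,f)=\left(\frac1{2\pi}\int_0^{2\pi}|f(re^{i\theta})|^p\,d\theta\right)^{1/p}$ and $\|f\|_p=\sup_{0<r<1}M_p(r,f)$, and $\|f\|_\infty=\sup_{z\in\mathbb{D}}|f(z)|$. *)

theory Defs
  imports "HOL-Analysis.Analysis"
begin

text \<open>
  Functions on the unit disk \<open>ball 0 1\<close> and on the unit circle \<open>sphere 0 1\<close> are represented by
  total functions on \<^typ>\<open>complex\<close>; every notion below looks at their values on the disk (or on the
  circle) only. Measures on the circle are transported to the parameter interval \<open>{0..2 * pi}\<close> by
  \<^const>\<open>cis\<close>. Exponents \<open>p\<close> in \<open>(0, \<infinity>]\<close> are of type \<^typ>\<open>ennreal\<close>.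
\<close>

subsection \<open>Wirtinger derivatives\<close>

definition deriv_x :: "(complex \<Rightarrow> complex) \<Rightarrow> complex \<Rightarrow> complex" where
  "deriv_x f z = vector_derivative (\<lambda>t. f (z + of_real t)) (at 0)"

definition deriv_y :: "(complex \<Rightarrow> complex) \<Rightarrow> complex \<Rightarrow> complex" where
  "deriv_y f z = vector_derivative (\<lambda>t. f (z + \<i> * of_real t)) (at 0)"

definition wirtinger :: "(complex \<Rightarrow> complex) \<Rightarrow> complex \<Rightarrow> complex" where
  "wirtinger f z = (deriv_x f z - \<i> * deriv_y f z) / 2"

definition wirtinger_bar :: "(complex \<Rightarrow> complex) \<Rightarrow> complex \<Rightarrow> complex" where
  "wirtinger_bar f z = (deriv_x f z + \<i> * deriv_y f z) / 2"

subsection \<open>The \<open>\<alpha>\<close>-harmonic Poisson integral\<close>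

definition alpha_poisson_kernel :: "real \<Rightarrow> complex \<Rightarrow> complex" where
  "alpha_poisson_kernel \<alpha> z =
     of_real ((1 - (norm z)\<^sup>2) powr (\<alpha> + 1)) / ((1 - z) * (1 - cnj z) powr of_real (\<alpha> + 1))"

definition alpha_poisson :: "real \<Rightarrow> (complex \<Rightarrow> complex) \<Rightarrow> complex \<Rightarrow> complex" where
  "alpha_poisson \<alpha> F z =
     (1 / (2 * pi)) *\<^sub>R
       (LINT \<theta>|lebesgue_on {0..2*pi}. alpha_poisson_kernel \<alpha> (z * cis (- \<theta>)) * F (cis \<theta>))"

subsection \<open>Absolutely continuous functions on the circle\<close>

text \<open>
  A division of \<open>\<Union>d\<close> is a finite set of non-overlapping compact intervals; one-point intervals,
  which it may contain, contribute nothing to either sum.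
\<close>

definition abs_continuous_on :: "real \<Rightarrow> real \<Rightarrow> (real \<Rightarrow> 'a::real_normed_vector) \<Rightarrow> bool" where
  "abs_continuous_on a b g \<longleftrightarrow>
     (\<forall>\<epsilon>>0. \<exists>\<delta>>0. \<forall>d. d division_of \<Union>d \<longrightarrow> \<Union>d \<subseteq> {a..b} \<longrightarrow> (\<Sum>K\<in>d. Sup K - Inf K) < \<delta> \<longrightarrow>
        (\<Sum>K\<in>d. norm (g (Sup K) - g (Inf K))) < \<epsilon>)"

definition abs_continuous_circle :: "(complex \<Rightarrow> complex) \<Rightarrow> bool" where
  "abs_continuous_circle F \<longleftrightarrow> abs_continuous_on 0 (2 * pi) (\<lambda>\<theta>. F (cis \<theta>))"

text \<open>
  The derivative along the circle, as a function of the point \<open>\<zeta>\<close> of the circle; the lemma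
  \<open>circle_deriv_cis\<close> gives the usual form in the angle. Where the derivative does not exist, which
  happens only on a null set if \<open>F\<close> is absolutely continuous, the value is arbitrary.
\<close>

definition circle_deriv :: "(complex \<Rightarrow> complex) \<Rightarrow> complex \<Rightarrow> complex" where
  "circle_deriv F \<zeta> = vector_derivative (\<lambda>t. F (\<zeta> * cis t)) (at 0)"

lemma circle_deriv_cis:
  "circle_deriv F (cis \<theta>) = vector_derivative (\<lambda>t. F (cis t)) (at \<theta>)"
proof -
  have "((\<lambda>t. F (cis \<theta> * cis t)) has_vector_derivative D) (at 0) \<longleftrightarrow>
        ((\<lambda>t. F (cis t)) has_vector_derivative D) (at \<theta>)" for D
  proof
    assume "((\<lambda>t. F (cis \<theta> * cis t)) has_vector_derivative D) (at 0)"
    then have "((\<lambda>t. F (cis (\<theta> + t))) has_vector_derivative D) (at (\<theta> - \<theta>))"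
      by (simp add: cis_mult)
    moreover have "((\<lambda>t. t - \<theta>) has_vector_derivative 1) (at \<theta>)"
      by (auto intro!: derivative_eq_intros)
    ultimately show "((\<lambda>t. F (cis t)) has_vector_derivative D) (at \<theta>)"
      using vector_diff_chain_at[of "\<lambda>t. t - \<theta>" 1 \<theta> "\<lambda>t. F (cis (\<theta> + t))" D]
      by (simp add: o_def)
  next
    assume "((\<lambda>t. F (cis t)) has_vector_derivative D) (at \<theta>)"
    then have "((\<lambda>t. F (cis t)) has_vector_derivative D) (at (\<theta> + 0))"
      by simp
    moreover have "((\<lambda>t. \<theta> + t) has_vector_derivative 1) (at 0)"
      by (auto intro!: derivative_eq_intros)
    ultimately show "((\<lambda>t. F (cis \<theta> * cis t)) has_vector_derivative D) (at 0)"
      using vector_diff_chain_at[of "\<lambda>t. \<theta> + t" 1 0 "\<lambda>t. F (cis t)" D]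
      by (simp add: o_def cis_mult)
  qed
  then show ?thesis
    by (simp add: circle_deriv_def vector_derivative_def)
qed

subsection \<open>Lebesgue spaces on the circle\<close>

definition Lp_circle :: "ennreal \<Rightarrow> (complex \<Rightarrow> complex) set" where
  "Lp_circle p =
     {g. (\<lambda>\<theta>. g (cis \<theta>)) \<in> borel_measurable (lebesgue_on {0..2*pi}) \<and>
         (if p = \<infinity> then \<exists>C. AE \<theta> in lebesgue_on {0..2*pi}. norm (g (cis \<theta>)) \<le> C
          else integrable (lebesgue_on {0..2*pi}) (\<lambda>\<theta>. norm (g (cis \<theta>)) powr enn2real p))}"

subsection \<open>Generalized Hardy spaces\<close>

definition hardy_mean :: "real \<Rightarrow> real \<Rightarrow> (complex \<Rightarrow> complex) \<Rightarrow> real" where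
  "hardy_mean p r f =
     (1 / (2 * pi) * (LINT \<theta>|lebesgue_on {0..2*pi}. norm (f (of_real r * cis \<theta>)) powr p)) powr (1 / p)"

text \<open>
  For finite \<open>p\<close>, existence of the mean is integrability of the integrand (measurability with a
  finite integral: an infinite mean is excluded by finiteness of the norm in any case), and
  finiteness of a supremum is boundedness above.
\<close>

definition gen_hardy :: "ennreal \<Rightarrow> (complex \<Rightarrow> complex) set" where
  "gen_hardy p =
     {f. f \<in> borel_measurable (lebesgue_on (ball 0 1)) \<and>
         (if p = \<infinity> then bdd_above ((\<lambda>z. norm (f z)) ` ball 0 1)
          else (\<forall>r\<in>{0<..<1}. integrable (lebesgue_on {0..2*pi})
                  (\<lambda>\<theta>. norm (f (of_real r * cis \<theta>)) powr enn2real p)) \<and>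
               bdd_above ((\<lambda>r. hardy_mean (enn2real p) r f) ` {0<..<1}))}"

end

theory Submission
  imports Defs "HOL-Complex_Analysis.Complex_Analysis"
begin

text \<open>
  Put \<open>d = 1 - (norm z)\<^sup>2\<close>. The Wirtinger derivative of the kernel with respect to \<open>cnj z\<close> is
  \<open>(\<alpha> + 1) * d powr \<alpha> * (1 - cnj z) powr (- \<alpha> - 2)\<close>, and rotations do not change \<open>d\<close>. Hence the
  derivative of \<open>f\<close> with respect to \<open>cnj z\<close> is \<open>d powr \<alpha> * cnj (g z)\<close> with \<open>g\<close> holomorphic in the
  disk (\<open>has_wirtinger_alpha_poisson\<close>, \<open>integral_kernel_dzbar\<close>,
  \<open>poisson_antianalytic_part_holomorphic\<close>). Since \<open>\<alpha> < 0\<close>, the radial factor blows up at the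
  boundary, so on the circle of radius \<open>r\<close> a nonzero Taylor coefficient of \<open>g\<close> would make the
  corresponding Fourier coefficient of this derivative grow like \<open>(1 - r\<^sup>2) powr \<alpha>\<close>.

  If the derivative with respect to \<open>cnj z\<close> has a finite Hardy norm, its Fourier coefficients on
  these circles are bounded (\<open>gen_hardy_circle_integral_bounded\<close>), and therefore \<open>g = 0\<close>.

  If instead the derivative with respect to \<open>z\<close> has a finite Hardy norm, the two derivatives are
  linked by the angular derivative of \<open>f\<close>: integration by parts
  (\<open>has_wirtinger_circle_by_parts\<close>) expresses each Fourier coefficient of the one by a Fourier
  coefficient of the other and one of \<open>f\<close>. The latter is \<open>O((1 - r\<^sup>2) powr (\<alpha> / 2))\<close> because
  comparison with the classical Poisson kernel gives such a bound for \<open>f\<close> itself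
  (\<open>norm_alpha_poisson_le\<close>). This is still of smaller order than \<open>(1 - r\<^sup>2) powr \<alpha>\<close>, and again
  \<open>g = 0\<close> (\<open>holomorphic_eq_0_if_small_growth\<close>).

  With \<open>g = 0\<close> the total derivative of \<open>f\<close> is complex linear, so \<open>f\<close> is analytic. Conversely, for
  analytic \<open>f\<close> the derivative with respect to \<open>cnj z\<close> vanishes in the disk and belongs to every
  Hardy space.
\<close>

section \<open>Wirtinger calculus\<close>

text \<open>
  Total differentiability with prescribed Wirtinger derivatives \<open>a\<close> and \<open>b\<close>. The operators
  \<^const>\<open>wirtinger\<close> and \<^const>\<open>wirtinger_bar\<close> only see the two partial derivatives; the total
  derivative is what obeys a chain rule, and with \<open>b = 0\<close> it is complex differentiability.
\<close>
definition has_wirtinger :: "(complex \<Rightarrow> complex) \<Rightarrow> complex \<Rightarrow> complex \<Rightarrow> complex \<Rightarrow> bool" where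
  "has_wirtinger f a b z \<longleftrightarrow> (f has_derivative (\<lambda>h. a * h + b * cnj h)) (at z)"

lemma has_wirtinger_deriv_x:
  assumes "has_wirtinger f a b z" shows "deriv_x f z = a + b"
proof -
  have f: "(f has_derivative (\<lambda>h. a * h + b * cnj h)) (at (z + of_real 0))"
    using assms by (simp add: has_wirtinger_def)
  have "((\<lambda>t. f (z + of_real t)) has_derivative (\<lambda>t. a * of_real t + b * cnj (of_real t))) (at 0)"
    by (rule has_derivative_compose[where f = "\<lambda>t. z + of_real t", OF _ f])
       (auto intro!: derivative_eq_intros)
  then have "((\<lambda>t. f (z + of_real t)) has_vector_derivative (a + b)) (at 0)"
    by (simp add: has_vector_derivative_def scaleR_conv_of_real algebra_simps)
  then show ?thesis
    unfolding deriv_x_def by (rule vector_derivative_at)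
qed

lemma has_wirtinger_deriv_y:
  assumes "has_wirtinger f a b z" shows "deriv_y f z = \<i> * (a - b)"
proof -
  have f: "(f has_derivative (\<lambda>h. a * h + b * cnj h)) (at (z + \<i> * of_real 0))"
    using assms by (simp add: has_wirtinger_def)
  have "((\<lambda>t. f (z + \<i> * of_real t)) has_derivative
          (\<lambda>t. a * (\<i> * of_real t) + b * cnj (\<i> * of_real t))) (at 0)"
    by (rule has_derivative_compose[where f = "\<lambda>t. z + \<i> * of_real t", OF _ f])
       (auto intro!: derivative_eq_intros)
  then have "((\<lambda>t. f (z + \<i> * of_real t)) has_vector_derivative (\<i> * (a - b))) (at 0)"
    by (simp add: has_vector_derivative_def scaleR_conv_of_real algebra_simps)
  then show ?thesis
    unfolding deriv_y_def by (rule vector_derivative_at)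
qed

lemma wirtinger_eqI: "has_wirtinger f a b z \<Longrightarrow> wirtinger f z = a"
  by (simp add: wirtinger_def has_wirtinger_deriv_x has_wirtinger_deriv_y field_simps)

lemma wirtinger_bar_eqI: "has_wirtinger f a b z \<Longrightarrow> wirtinger_bar f z = b"
  by (simp add: wirtinger_bar_def has_wirtinger_deriv_x has_wirtinger_deriv_y field_simps)

lemma has_wirtinger_bar_zero_iff:
  "has_wirtinger f a 0 z \<longleftrightarrow> (f has_field_derivative a) (at z)"
  by (simp add: has_wirtinger_def has_field_derivative_def)

lemma has_wirtinger_mult:
  assumes "has_wirtinger f a b z" "has_wirtinger g c d z"
  shows "has_wirtinger (\<lambda>z. f z * g z) (a * g z + f z * c) (b * g z + f z * d) z"
  unfolding has_wirtinger_def
  by (rule has_derivative_eq_rhs[OF has_derivative_mult[OF assms[unfolded has_wirtinger_def]]])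
     (auto simp: algebra_simps)

lemma has_wirtinger_compose_holomorphic:
  assumes "has_wirtinger f a b z" "(g has_field_derivative g') (at (f z))"
  shows "has_wirtinger (\<lambda>z. g (f z)) (g' * a) (g' * b) z"
  unfolding has_wirtinger_def
  by (rule has_derivative_eq_rhs[OF has_derivative_compose[OF assms(1)[unfolded has_wirtinger_def]
        assms(2)[unfolded has_field_derivative_def]]])
     (auto simp: algebra_simps)

lemma has_wirtinger_cnj: "has_wirtinger cnj 0 1 z"
  by (simp add: has_wirtinger_def)

lemma has_wirtinger_affine:
  assumes "has_wirtinger K a b (z * u)"
  shows "has_wirtinger (\<lambda>z. K (z * u) * c) (a * u * c) (b * cnj u * c) z"
proof -
  have "((\<lambda>z. K (z * u)) has_derivative (\<lambda>h. a * (h * u) + b * cnj (h * u))) (at z)"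
    by (rule has_derivative_compose[where f = "\<lambda>z. z * u",
          OF _ assms[unfolded has_wirtinger_def]])
       (auto intro!: derivative_eq_intros)
  then show ?thesis
    unfolding has_wirtinger_def
    by (rule has_derivative_eq_rhs[OF has_derivative_mult_left]) (auto simp: algebra_simps)
qed

text \<open>
  The Leibniz rule for total derivatives, applied to the operators \<open>h \<mapsto> a * h + b * cnj h\<close>. These
  depend continuously on \<open>a\<close> and \<open>b\<close> in the operator norm, and evaluating the integrated operator
  at \<open>h\<close> integrates \<open>a\<close> and \<open>b\<close> separately.
\<close>
lemma has_wirtinger_integral:
  fixes k ka kb :: "complex \<Rightarrow> real \<Rightarrow> complex"
  assumes U: "open U" "convex U" "z \<in> U"
    and k: "\<And>x t. x \<in> U \<Longrightarrow> t \<in> {a..b} \<Longrightarrow> has_wirtinger (\<lambda>x. k x t) (ka x t) (kb x t) x"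
    and cont: "\<And>x. x \<in> U \<Longrightarrow> continuous_on {a..b} (k x)"
    and ca: "continuous_on (U \<times> {a..b}) (\<lambda>(x, t). ka x t)"
    and cb: "continuous_on (U \<times> {a..b}) (\<lambda>(x, t). kb x t)"
  shows "has_wirtinger (\<lambda>x. integral {a..b} (k x)) (integral {a..b} (ka z)) (integral {a..b} (kb z)) z"
proof -
  define D where "D x t = blinfun_mult_right (ka x t) + (blinfun_mult_right (kb x t) o\<^sub>L Blinfun cnj)" for x t
  have Dapp: "blinfun_apply (D x t) h = ka x t * h + kb x t * cnj h" for x t h
    by (simp add: D_def blinfun.add_left bounded_linear_Blinfun_apply bounded_linear_cnj)
  have contD: "continuous_on (U \<times> {a..b}) (\<lambda>(x, t). D x t)"
    using ca cb unfolding D_def split_beta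
    by (intro continuous_intros
          bounded_linear.continuous_on[OF bounded_linear_blinfun_mult_right]) auto
  have slice: "continuous_on {a..b} (g z)" if "continuous_on (U \<times> {a..b}) (\<lambda>(x, t). g x t)"
    for g :: "complex \<Rightarrow> real \<Rightarrow> 'a::topological_space"
    by (rule continuous_on_compose2[OF that, of "{a..b}" "\<lambda>t. (z, t)", simplified])
       (use U in \<open>auto intro!: continuous_intros\<close>)
  have "((\<lambda>x. integral (cbox a b) (k x)) has_derivative blinfun_apply (integral (cbox a b) (D z))) (at z within U)"
  proof (rule leibniz_rule)
    fix x t assume "x \<in> U" "t \<in> cbox a b"
    then show "((\<lambda>x. k x t) has_derivative blinfun_apply (D x t)) (at x within U)"
      using k[of x t] by (simp add: Dapp[abs_def] has_wirtinger_def has_derivative_at_withinI)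
  next
    show "k x integrable_on cbox a b" if "x \<in> U" for x
      using cont[OF that] by (simp add: integrable_continuous_real)
  next
    show "continuous_on (U \<times> cbox a b) (\<lambda>(x, t). D x t)"
      using contD by simp
  qed (use U in simp_all)
  moreover
  have "blinfun_apply (integral (cbox a b) (D z)) h =
     integral {a..b} (ka z) * h + integral {a..b} (kb z) * cnj h" for h
    using integrable_continuous_real[OF slice[OF contD]] integrable_continuous_real[OF slice[OF ca]]
      integrable_continuous_real[OF slice[OF cb]]
    by (subst blinfun_apply_integral) (auto simp: Dapp integral_add integrable_on_mult_left)
  then have "blinfun_apply (integral (cbox a b) (D z)) =
     (\<lambda>h. integral {a..b} (ka z) * h + integral {a..b} (kb z) * cnj h)"
    by (rule ext)
  ultimately show ?thesis
    unfolding has_wirtinger_def at_within_open[OF U(3,1)] by simp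
qed

section \<open>The kernel and its Wirtinger derivatives\<close>

lemma disk_nonneg_reals:
  assumes "norm (w::complex) < 1" shows "1 - w \<notin> \<real>\<^sub>\<le>\<^sub>0"
proof -
  have "Re w < 1" using complex_Re_le_cmod[of w] assms by linarith
  then show ?thesis by (auto simp: complex_nonpos_Reals_iff)
qed

text \<open>
  In this form the radial factor is a holomorphic function of \<open>z * cnj z\<close>, so that the chain rule
  for \<^const>\<open>has_wirtinger\<close> applies to it.
\<close>
lemma radial_powr:
  assumes "norm (z::complex) < 1"
  shows "of_real ((1 - (norm z)\<^sup>2) powr a) = (1 - z * cnj z) powr of_real a"
proof -
  have "(norm z)\<^sup>2 \<le> 1" using assms by (simp add: power_le_one)
  then show ?thesis
    by (simp add: powr_of_real[symmetric] complex_norm_square flip: of_real_power)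
qed

text \<open>
  The logarithmic derivative of the kernel with respect to \<open>z\<close>, multiplied by the kernel.
\<close>
definition kernel_dz :: "real \<Rightarrow> complex \<Rightarrow> complex" where
  "kernel_dz \<alpha> z = alpha_poisson_kernel \<alpha> z *
      (1 / (1 - z) - of_real (\<alpha> + 1) * cnj z / of_real (1 - (norm z)\<^sup>2))"

text \<open>
  The Wirtinger derivative of the kernel with respect to \<open>cnj z\<close>. Its shape drives the whole
  proof: a radial factor times an antianalytic function.
\<close>
definition kernel_dzbar :: "real \<Rightarrow> complex \<Rightarrow> complex" where
  "kernel_dzbar \<alpha> z = of_real (\<alpha> + 1) * of_real ((1 - (norm z)\<^sup>2) powr \<alpha>)
      * (1 - cnj z) powr of_real (- \<alpha> - 2)"

text \<open>
  With \<open>u = 1 - z * cnj z\<close>, \<open>v = 1 - z\<close>, \<open>w = 1 - cnj z\<close> and \<open>b = \<alpha> + 1\<close> the kernel is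
  \<open>u powr b * inverse v * w powr - b\<close>. Differentiating in \<open>cnj z\<close> gives
  \<open>b * u powr (b - 1) * w powr (- b - 1) * ((u - z * w) / v)\<close>, and \<open>u - z * w = v\<close> removes the last
  factor.
\<close>
lemma has_wirtinger_kernel:
  assumes "norm z < 1"
  shows "has_wirtinger (alpha_poisson_kernel \<alpha>) (kernel_dz \<alpha> z) (kernel_dzbar \<alpha> z) z"
proof -
  define b :: complex where "b = of_real (\<alpha> + 1)"
  have n: "norm (z * cnj z) < 1" using assms by (simp add: norm_mult power_less_one_iff flip: power2_eq_square)
  define u v w where "u = 1 - z * cnj z" and "v = 1 - z" and "w = 1 - cnj z"
  have nz: "u \<noteq> 0" "v \<noteq> 0" "w \<noteq> 0"
    using disk_nonneg_reals[OF n] disk_nonneg_reals[OF assms] disk_nonneg_reals[of "cnj z"] assms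
    by (auto simp: u_def v_def w_def)
  have id: "has_wirtinger (\<lambda>z. z) 1 0 z" by (simp add: has_wirtinger_def)
  have zz: "has_wirtinger (\<lambda>z. z * cnj z) (cnj z) z z"
    using has_wirtinger_mult[OF id has_wirtinger_cnj] by simp
  have 1: "has_wirtinger (\<lambda>z. (1 - z * cnj z) powr b)
      (- b * u powr (b - 1) * cnj z) (- b * u powr (b - 1) * z) z"
    using disk_nonneg_reals[OF n]
    by (intro has_wirtinger_compose_holomorphic[OF zz, of "\<lambda>s. (1 - s) powr b"])
       (auto intro!: derivative_eq_intros simp: u_def)
  have 2: "has_wirtinger (\<lambda>z. inverse (1 - z)) (inverse v ^ 2 * 1) (inverse v ^ 2 * 0) z"
    using nz(2) 
    by (intro has_wirtinger_compose_holomorphic[OF id, of "\<lambda>s. inverse (1 - s)"])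
       (auto intro!: derivative_eq_intros simp: v_def power2_eq_square)
  have 3: "has_wirtinger (\<lambda>z. (1 - cnj z) powr - b) (b * w powr (- b - 1) * 0) (b * w powr (- b - 1) * 1) z"
    using disk_nonneg_reals[of "cnj z"] assms
    by (intro has_wirtinger_compose_holomorphic[OF has_wirtinger_cnj, of "\<lambda>s. (1 - s) powr - b"])
       (auto intro!: derivative_eq_intros simp: w_def)
  have K: "alpha_poisson_kernel \<alpha> x = (1 - x * cnj x) powr b * (inverse (1 - x) * (1 - cnj x) powr - b)"
    if "norm x < 1" for x
    using radial_powr[OF that, of "\<alpha> + 1"]
    by (simp add: alpha_poisson_kernel_def b_def powr_minus divide_simps del: of_real_add)
  have un: "u = of_real (1 - (norm z)\<^sup>2)"
    by (simp add: u_def complex_norm_square flip: of_real_power)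
  have ub: "u powr (b - 1) = u powr b / u" "w powr (- b - 1) = w powr - b / w"
    using nz by (simp_all add: powr_diff)
  have e: "b - 1 = of_real \<alpha>" "- b - 1 = of_real (- \<alpha> - 2)"
    by (simp_all add: b_def)
  have "has_wirtinger (\<lambda>x. (1 - x * cnj x) powr b * (inverse (1 - x) * (1 - cnj x) powr - b))
          (kernel_dz \<alpha> z) (kernel_dzbar \<alpha> z) z"
  proof -
    have a: "- b * u powr (b - 1) * cnj z * (inverse (1 - z) * (1 - cnj z) powr - b) +
        (1 - z * cnj z) powr b * (inverse v ^ 2 * 1 * (1 - cnj z) powr - b +
           inverse (1 - z) * (b * w powr (- b - 1) * 0)) = kernel_dz \<alpha> z"
      unfolding kernel_dz_def K[OF assms] b_def[symmetric] un[symmetric]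
        u_def[symmetric] v_def[symmetric] w_def[symmetric] ub(1)
      using nz by (simp add: field_simps power2_eq_square)
    have "- b * u powr (b - 1) * z * (inverse (1 - z) * (1 - cnj z) powr - b) +
        (1 - z * cnj z) powr b * (inverse v ^ 2 * 0 * (1 - cnj z) powr - b +
           inverse (1 - z) * (b * w powr (- b - 1) * 1))
      = b * (u powr b / u) * (w powr - b / w) * ((u - z * w) / v)"
      unfolding ub u_def[symmetric] v_def[symmetric] w_def[symmetric]
      using nz by (simp add: field_simps)
    also have "u - z * w = v" by (simp add: u_def w_def v_def algebra_simps)
    also have "b * (u powr b / u) * (w powr - b / w) * (v / v) = kernel_dzbar \<alpha> z"
      using nz radial_powr[OF assms, of \<alpha>]
      unfolding ub[symmetric] e kernel_dzbar_def
      by (simp add: b_def u_def w_def)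
    finally show ?thesis
      using has_wirtinger_mult[OF 1 has_wirtinger_mult[OF 2 3]] a by simp
  qed
  then show ?thesis
    unfolding has_wirtinger_def
    by (rule has_derivative_transform_within_open[of _ _ _ _ "ball 0 1"])
       (use assms in \<open>auto simp: K\<close>)
qed

lemma continuous_on_disk_powr:
  fixes f :: "'a::topological_space \<Rightarrow> complex"
  assumes "continuous_on A f" "\<And>x. x \<in> A \<Longrightarrow> norm (f x) < 1"
  shows "continuous_on A (\<lambda>x. (1 - f x) powr s)"
proof (rule continuous_on_compose2[of "ball 0 1" "\<lambda>w. (1 - w) powr s" A f])
  show "continuous_on (ball 0 1) (\<lambda>w::complex. (1 - w) powr s)"
    using disk_nonneg_reals
    by (intro holomorphic_on_imp_continuous_on holomorphic_intros) auto
qed (use assms in auto)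

lemma continuous_on_kernel:
  "continuous_on (ball 0 1) (alpha_poisson_kernel \<alpha>)"
  using has_wirtinger_kernel
  by (auto intro!: continuous_at_imp_continuous_on has_derivative_continuous simp: has_wirtinger_def)

lemma disk_radial_pos: "norm (z::complex) < 1 \<Longrightarrow> 0 < 1 - (norm z)\<^sup>2"
  by (simp add: abs_square_less_1)

lemma continuous_on_kernel_dz:
  "continuous_on (ball 0 1) (kernel_dz \<alpha>)"
  unfolding kernel_dz_def
proof (intro continuous_intros continuous_on_kernel ballI)
  fix z :: complex assume "z \<in> ball 0 1"
  then show "1 - z \<noteq> 0" "complex_of_real (1 - (norm z)\<^sup>2) \<noteq> 0"
    using disk_radial_pos[of z] by (auto simp del: of_real_diff)
qed

lemma continuous_on_kernel_dzbar:
  "continuous_on (ball 0 1) (kernel_dzbar \<alpha>)"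
  unfolding kernel_dzbar_def
  using disk_radial_pos by (intro continuous_intros continuous_on_disk_powr) force+

section \<open>The Poisson integral and its derivatives\<close>

text \<open>
  Divisions consisting of a single interval give uniform continuity.
\<close>
lemma abs_continuous_on_imp_continuous_on:
  assumes "abs_continuous_on a b g" shows "continuous_on {a..b} g"
proof (rule uniformly_continuous_imp_continuous, unfold uniformly_continuous_on_def, intro allI impI)
  fix e :: real assume "e > 0"
  then have "\<exists>d>0. \<forall>D. D division_of \<Union>D \<longrightarrow> \<Union>D \<subseteq> {a..b} \<longrightarrow> (\<Sum>K\<in>D. Sup K - Inf K) < d \<longrightarrow>
        (\<Sum>K\<in>D. norm (g (Sup K) - g (Inf K))) < e"
    using assms unfolding abs_continuous_on_def by (elim allE impE)
  then obtain d where d: "d > 0"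
    and D: "\<forall>D. D division_of \<Union>D \<longrightarrow> \<Union>D \<subseteq> {a..b} \<longrightarrow> (\<Sum>K\<in>D. Sup K - Inf K) < d \<longrightarrow>
        (\<Sum>K\<in>D. norm (g (Sup K) - g (Inf K))) < e"
    by (elim exE conjE)
  have le: "dist (g y) (g x) < e" if "x \<in> {a..b}" "y \<in> {a..b}" "x \<le> y" "y - x < d" for x y
  proof -
    have "{{x..y}} division_of \<Union>{{x..y}}"
      using that division_of_self[of x y] by simp
    then show ?thesis
      using D[THEN spec, of "{{x..y}}"] that by (auto simp: dist_norm)
  qed
  show "\<exists>d>0. \<forall>x\<in>{a..b}. \<forall>y\<in>{a..b}. dist y x < d \<longrightarrow> dist (g y) (g x) < e"
  proof (intro exI[of _ d] conjI ballI impI)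
    fix x y assume "x \<in> {a..b}" "y \<in> {a..b}" "dist y x < d"
    then show "dist (g y) (g x) < e"
      using le[of x y] le[of y x] by (cases "x \<le> y") (auto simp: dist_norm norm_minus_commute)
  qed (rule d)
qed

lemma alpha_poisson_eq_integral:
  fixes F :: "complex \<Rightarrow> complex"
  assumes F: "continuous_on {0..2*pi} (\<lambda>t. F (cis t))" and z: "norm z < 1"
  shows "continuous_on {0..2*pi} (\<lambda>t. alpha_poisson_kernel \<alpha> (z * cis (- t)) * (F (cis t) / (2 * pi)))"
    and "alpha_poisson \<alpha> F z =
      integral {0..2*pi} (\<lambda>t. alpha_poisson_kernel \<alpha> (z * cis (- t)) * (F (cis t) / (2 * pi)))"
proof -
  have c: "continuous_on {0..2*pi} (\<lambda>t. alpha_poisson_kernel \<alpha> (z * cis (- t)) * F (cis t))"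
    using z by (intro continuous_intros F continuous_on_compose2[OF continuous_on_kernel])
      (auto simp: norm_mult)
  then show "continuous_on {0..2*pi} (\<lambda>t. alpha_poisson_kernel \<alpha> (z * cis (- t)) * (F (cis t) / (2 * pi)))"
    unfolding times_divide_eq_right by (intro continuous_on_divide c continuous_on_const) auto
  show "alpha_poisson \<alpha> F z =
      integral {0..2*pi} (\<lambda>t. alpha_poisson_kernel \<alpha> (z * cis (- t)) * (F (cis t) / (2 * pi)))"
    using lebesgue_integral_eq_integral[OF continuous_imp_integrable_real[OF c]]
    by (simp add: alpha_poisson_def scaleR_conv_of_real)
qed

lemma has_wirtinger_alpha_poisson:
  fixes F :: "complex \<Rightarrow> complex"
  assumes F: "continuous_on {0..2*pi} (\<lambda>t. F (cis t))" and z: "norm z < 1"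
  shows "has_wirtinger (alpha_poisson \<alpha> F)
     (integral {0..2*pi} (\<lambda>t. kernel_dz \<alpha> (z * cis (- t)) * cis (- t) * (F (cis t) / (2 * pi))))
     (integral {0..2*pi} (\<lambda>t. kernel_dzbar \<alpha> (z * cis (- t)) * cis t * (F (cis t) / (2 * pi)))) z"
    (is "has_wirtinger _ (integral _ (?a z)) (integral _ (?b z)) _")
proof -
  have [continuous_intros]:
    "continuous_on (ball (0::complex) 1 \<times> {0..2*pi}) (\<lambda>p. F (cis (snd p)))"
    by (rule continuous_on_compose2[OF F]) (auto intro!: continuous_intros)
  have cc: "continuous_on (ball 0 1 \<times> {0..2*pi}) (\<lambda>p. k (fst p * cis (- snd p)))"
    if "continuous_on (ball 0 1) k" for k :: "complex \<Rightarrow> complex"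
    by (rule continuous_on_compose2[OF that]) (auto intro!: continuous_intros simp: norm_mult)
  have "has_wirtinger (\<lambda>x. integral {0..2*pi}
      (\<lambda>t. alpha_poisson_kernel \<alpha> (x * cis (- t)) * (F (cis t) / (2 * pi))))
      (integral {0..2*pi} (?a z)) (integral {0..2*pi} (?b z)) z"
  proof (rule has_wirtinger_integral[of "ball 0 1"])
    fix x t assume "x \<in> ball (0::complex) 1" "t \<in> {0..2*pi}"
    then have "norm (x * cis (- t)) < 1"
      by (simp add: norm_mult)
    from has_wirtinger_affine[OF has_wirtinger_kernel[OF this], of \<alpha> "F (cis t) / (2 * pi)"]
    show "has_wirtinger (\<lambda>x. alpha_poisson_kernel \<alpha> (x * cis (- t)) * (F (cis t) / (2 * pi))) (?a x t) (?b x t) x"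
      unfolding cis_cnj by simp
  next
    show "continuous_on (ball 0 1 \<times> {0..2 * pi}) (\<lambda>(x, t). ?a x t)"
         "continuous_on (ball 0 1 \<times> {0..2 * pi}) (\<lambda>(x, t). ?b x t)"
      unfolding split_beta
      by (intro continuous_intros cc continuous_on_kernel_dz continuous_on_kernel_dzbar; simp)+
  qed (use z alpha_poisson_eq_integral(1)[OF F] in auto)
  then show ?thesis
    unfolding has_wirtinger_def
    by (rule has_derivative_transform_within_open[of _ _ _ _ "ball 0 1"])
       (use z alpha_poisson_eq_integral(2)[OF F] in auto)
qed

text \<open>
  The function \<open>g\<close> for which the Wirtinger derivative of \<^term>\<open>alpha_poisson \<alpha> F\<close> with respect to
  \<open>cnj z\<close> is \<open>(1 - (norm z)\<^sup>2) powr \<alpha> * cnj (g z)\<close>. It is written as the conjugate of the antianalytic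
  factor, a Cauchy-type integral holomorphic in \<open>w\<close>, so that Cauchy's formula applies without
  reversing the circle.
\<close>
definition poisson_antianalytic_part :: "real \<Rightarrow> (complex \<Rightarrow> complex) \<Rightarrow> complex \<Rightarrow> complex" where
  "poisson_antianalytic_part \<alpha> F w = integral {0..2*pi} (\<lambda>t.
     of_real (\<alpha> + 1) * (1 - w * cis (- t)) powr of_real (- \<alpha> - 2) * (cis (- t) * (cnj (F (cis t)) / (2 * pi))))"

lemma poisson_antianalytic_part_holomorphic:
  fixes F :: "complex \<Rightarrow> complex"
  assumes F: "continuous_on {0..2*pi} (\<lambda>t. F (cis t))"
  shows "poisson_antianalytic_part \<alpha> F holomorphic_on ball 0 1"
proof -
  define \<phi> where "\<phi> t = cis (- t) * (cnj (F (cis t)) / (2 * pi))" for t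
  have \<phi>: "continuous_on {0..2*pi} \<phi>"
    unfolding \<phi>_def by (intro continuous_intros F) auto
  have \<phi>2 [continuous_intros]: "continuous_on (ball (0::complex) 1 \<times> {0..2*pi}) (\<lambda>p. \<phi> (snd p))"
    by (rule continuous_on_compose2[OF \<phi>]) (auto intro!: continuous_intros)
  have in_dom: "1 - x * cis (- t) \<notin> \<real>\<^sub>\<le>\<^sub>0" if "norm x < 1" for x t
    using disk_nonneg_reals[of "x * cis (- t)"] that by (simp add: norm_mult)
  have "(\<lambda>w. integral (cbox 0 (2*pi)) (\<lambda>t. of_real (\<alpha> + 1) * (1 - w * cis (- t)) powr of_real (- \<alpha> - 2) * \<phi> t))
      holomorphic_on ball 0 1"
  proof (rule leibniz_rule_holomorphic)
    fix x t assume "x \<in> ball (0::complex) 1" "t \<in> cbox 0 (2*pi)"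
    then show "((\<lambda>w. of_real (\<alpha> + 1) * (1 - w * cis (- t)) powr of_real (- \<alpha> - 2) * \<phi> t)
      has_field_derivative of_real (\<alpha> + 1) * (of_real (- \<alpha> - 2) * (1 - x * cis (- t)) powr (of_real (- \<alpha> - 2) - 1)
         * (- cis (- t))) * \<phi> t) (at x within ball 0 1)"
      using in_dom[of x t] by (auto intro!: derivative_eq_intros)
  next
    fix x assume "x \<in> ball (0::complex) 1"
    then show "(\<lambda>t. of_real (\<alpha> + 1) * (1 - x * cis (- t)) powr of_real (- \<alpha> - 2) * \<phi> t) integrable_on cbox 0 (2*pi)"
      unfolding cbox_interval
      by (intro integrable_continuous_real continuous_intros continuous_on_disk_powr \<phi>) (auto simp: norm_mult)
  next
    show "continuous_on (ball 0 1 \<times> cbox 0 (2*pi))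
      (\<lambda>(x, t). of_real (\<alpha> + 1) * (of_real (- \<alpha> - 2) * (1 - x * cis (- t)) powr (of_real (- \<alpha> - 2) - 1)
         * (- cis (- t))) * \<phi> t)"
      unfolding split_beta cbox_interval
      by (intro continuous_intros continuous_on_disk_powr) (auto simp: norm_mult)
  qed auto
  then show ?thesis
    unfolding poisson_antianalytic_part_def[abs_def] \<phi>_def cbox_interval .
qed

lemma integral_kernel_dzbar:
  fixes F :: "complex \<Rightarrow> complex"
  assumes z: "norm z < 1"
  shows "integral {0..2*pi} (\<lambda>t. kernel_dzbar \<alpha> (z * cis (- t)) * cis t * (F (cis t) / (2 * pi)))
     = of_real ((1 - (norm z)\<^sup>2) powr \<alpha>) * cnj (poisson_antianalytic_part \<alpha> F z)"
proof -
  have "kernel_dzbar \<alpha> (z * cis (- t)) * cis t * (F (cis t) / (2 * pi)) =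
    of_real ((1 - (norm z)\<^sup>2) powr \<alpha>) * cnj (of_real (\<alpha> + 1) * (1 - z * cis (- t)) powr of_real (- \<alpha> - 2)
      * (cis (- t) * (cnj (F (cis t)) / (2 * pi))))" for t
  proof -
    have "cnj ((1 - z * cis (- t)) powr of_real (- \<alpha> - 2)) = (1 - cnj (z * cis (- t))) powr of_real (- \<alpha> - 2)"
      using disk_nonneg_reals[of "z * cis (- t)"] z
      by (subst cnj_powr) (auto simp: norm_mult complex_nonpos_Reals_iff)
    then show ?thesis
      by (simp add: kernel_dzbar_def norm_mult cis_cnj)
  qed
  then show ?thesis
    unfolding poisson_antianalytic_part_def integral_cnj
    by (simp only: integral_mult_right)
qed

section \<open>Fourier coefficients of the derivatives on circles\<close>

text \<open>
  Cauchy's formula for the \<open>n\<close>-th derivative at the centre, read as an integral over the angle.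
\<close>
lemma holomorphic_circle_coefficient:
  fixes g :: "complex \<Rightarrow> complex"
  assumes g: "g holomorphic_on ball 0 1" and r: "r \<in> {0<..<1}"
  shows "((\<lambda>\<theta>. cis (- (real n * \<theta>)) * g (of_real r * cis \<theta>)) has_integral
     2 * pi * of_real r ^ n * ((deriv ^^ n) g 0 / fact n)) {0..2*pi}"
proof -
  have sub: "cball (0::complex) r \<subseteq> ball 0 1" using r by auto
  have "((\<lambda>u. g u / (u - 0) ^ Suc n) has_contour_integral (2 * pi * \<i> / fact n * (deriv ^^ n) g 0)) (circlepath 0 r)"
    using r by (intro Cauchy_has_contour_integral_higher_derivative_circlepath
        holomorphic_on_imp_continuous_on holomorphic_on_subset[OF g]) (auto intro: order_trans[OF ball_subset_cball sub])
  then have "((\<lambda>t. g (0 + of_real r * cis t) / (0 + of_real r * cis t - 0) ^ Suc n * of_real r * \<i> * cis t)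
     has_integral (2 * pi * \<i> / fact n * (deriv ^^ n) g 0)) {0..2*pi}"
    unfolding circlepath_def by (subst (asm) has_contour_integral_part_circlepath_iff) auto
  from has_integral_mult_right[OF this, of "of_real r ^ n / \<i>"]
  have "((\<lambda>t. of_real r ^ n / \<i> * (g (0 + of_real r * cis t) / (0 + of_real r * cis t - 0) ^ Suc n * of_real r * \<i> * cis t))
     has_integral (2 * pi * of_real r ^ n * ((deriv ^^ n) g 0 / fact n))) {0..2*pi}"
    by (simp add: field_simps)
  moreover have "of_real r ^ n / \<i> * (g (0 + of_real r * cis t) / (0 + of_real r * cis t - 0) ^ Suc n * of_real r * \<i> * cis t)
      = cis (- (real n * t)) * g (of_real r * cis t)" for t
  proof -
    have "of_real r ^ n / \<i> * (g (0 + of_real r * cis t) / (0 + of_real r * cis t - 0) ^ Suc n * of_real r * \<i> * cis t)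
       = g (of_real r * cis t) / cis t ^ n"
      using r by (simp add: field_simps power_mult_distrib)
    also have "cis t ^ n = inverse (cis (- (real n * t)))"
      by (simp only: Complex.DeMoivre cis_inverse minus_minus)
    finally show ?thesis by (simp add: field_simps)
  qed
  ultimately show ?thesis by simp
qed

text \<open>
  The angular derivative of \<open>f\<close> on the circle of radius \<open>r\<close> is \<open>\<i> * (z * a - cnj z * b)\<close>; the
  identity is integration by parts against \<open>cis (k * \<theta>)\<close>, whose boundary terms cancel by
  periodicity. It trades one Wirtinger derivative for the other at the price of a Fourier
  coefficient of \<open>f\<close> itself.
\<close>
lemma has_wirtinger_circle_by_parts:
  assumes f: "\<And>\<theta>. has_wirtinger f (a (of_real r * cis \<theta>)) (b (of_real r * cis \<theta>)) (of_real r * cis \<theta>)"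
  shows "((\<lambda>\<theta>. cis (real k * \<theta>) * (of_real r * cis \<theta> * a (of_real r * cis \<theta>)
            - of_real r * cis (- \<theta>) * b (of_real r * cis \<theta>))) has_integral
       - (real k * integral {0..2*pi} (\<lambda>\<theta>. cis (real k * \<theta>) * f (of_real r * cis \<theta>)))) {0..2*pi}"
proof -
  let ?z = "\<lambda>\<theta>. of_real r * cis \<theta>"
  let ?D = "\<lambda>\<theta>. cis (real k * \<theta>) * (?z \<theta> * a (?z \<theta>) - of_real r * cis (- \<theta>) * b (?z \<theta>))"
  have fd: "((\<lambda>\<theta>. f (?z \<theta>)) has_vector_derivative
       \<i> * (?z \<theta> * a (?z \<theta>) - of_real r * cis (- \<theta>) * b (?z \<theta>))) (at \<theta> within S)" for \<theta> S
  proof -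
    have "((\<lambda>\<theta>. f (?z \<theta>)) has_derivative (\<lambda>h. a (?z \<theta>) * (of_real r * (h *\<^sub>R (\<i> * cis \<theta>)))
        + b (?z \<theta>) * cnj (of_real r * (h *\<^sub>R (\<i> * cis \<theta>))))) (at \<theta> within S)"
      by (rule has_derivative_compose[where f = ?z, OF _ f[unfolded has_wirtinger_def]])
         (auto intro!: derivative_eq_intros)
    then show ?thesis
      unfolding has_vector_derivative_def
      by (rule has_derivative_eq_rhs) (auto simp: scaleR_conv_of_real cis_cnj algebra_simps)
  qed
  have cd: "((\<lambda>\<theta>. cis (real k * \<theta>)) has_vector_derivative (\<i> * real k * cis (real k * \<theta>))) (at \<theta> within S)" for \<theta> S
    unfolding has_vector_derivative_def
    by (auto intro!: derivative_eq_intros simp: scaleR_conv_of_real algebra_simps)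
  have "((\<lambda>\<theta>. cis (real k * \<theta>) * (\<i> * (?z \<theta> * a (?z \<theta>) - of_real r * cis (- \<theta>) * b (?z \<theta>)))
       + \<i> * real k * cis (real k * \<theta>) * f (?z \<theta>)) has_integral
       (cis (real k * (2*pi)) * f (?z (2*pi)) - cis (real k * 0) * f (?z 0))) {0..2*pi}"
    by (intro fundamental_theorem_of_calculus has_vector_derivative_mult fd cd) auto
  moreover have "cis (real k * (2*pi)) = 1"
    using cis_multiple_2pi[of "real k"] by (simp add: mult.commute)
  ultimately have 1: "((\<lambda>\<theta>. cis (real k * \<theta>) * (\<i> * (?z \<theta> * a (?z \<theta>) - of_real r * cis (- \<theta>) * b (?z \<theta>)))
       + \<i> * real k * cis (real k * \<theta>) * f (?z \<theta>)) has_integral 0) {0..2*pi}"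
    by simp
  have "continuous_on {0..2*pi} (\<lambda>\<theta>. f (?z \<theta>))"
    using fd by (rule continuous_on_vector_derivative)
  then have "((\<lambda>\<theta>. cis (real k * \<theta>) * f (?z \<theta>)) has_integral
      integral {0..2*pi} (\<lambda>\<theta>. cis (real k * \<theta>) * f (?z \<theta>))) {0..2*pi}"
    by (intro integrable_integral integrable_continuous_real continuous_intros)
  from has_integral_diff[OF has_integral_mult_right[OF 1, of "- \<i>"] has_integral_mult_right[OF this, of "real k"]]
  show ?thesis by (simp add: algebra_simps)
qed

section \<open>Growth of the Poisson integral\<close>

text \<open>
  The integrand is the real part of \<open>h u = (1 + cnj z * u) / (1 - cnj z * u)\<close> at \<open>u = cis t\<close>. Since
  \<open>h\<close> is holomorphic near the closed disk, its mean over the circle is \<open>h 0 = 1\<close>.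
\<close>
lemma poisson_kernel_has_integral:
  fixes z :: complex
  assumes z: "norm z < 1"
  shows "((\<lambda>t. (1 - (norm z)\<^sup>2) / (norm (1 - z * cis (- t)))\<^sup>2) has_integral 2 * pi) {0..2*pi}"
proof -
  define h where "h u = (1 + cnj z * u) / (1 - cnj z * u)" for u
  have nz: "1 - cnj z * u \<noteq> 0" if "norm u \<le> 1" for u
  proof -
    have "norm (cnj z * u) < 1"
      using that z mult_le_one[of "norm z" "norm u"] mult_left_le[of "norm u" "norm z"]
      by (simp add: norm_mult)
    then show ?thesis by auto
  qed
  have "h holomorphic_on cball 0 1"
    unfolding h_def by (intro holomorphic_intros) (use nz in auto)
  then have "((\<lambda>u. h u / (u - 0)) has_contour_integral (2 * of_real pi * \<i> * h 0)) (circlepath 0 1)"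
    by (intro Cauchy_integral_circlepath holomorphic_on_imp_continuous_on
         holomorphic_on_subset[OF _ ball_subset_cball]) auto
  then have "((\<lambda>t. h (0 + of_real 1 * cis t) / (0 + of_real 1 * cis t - 0) * of_real 1 * \<i> * cis t)
     has_integral (2 * of_real pi * \<i> * h 0)) {0..2*pi}"
    unfolding circlepath_def by (subst (asm) has_contour_integral_part_circlepath_iff) auto
  then have "((\<lambda>t. \<i> * h (cis t)) has_integral (2 * of_real pi * \<i>)) {0..2*pi}"
    by (simp add: h_def mult.commute)
  from has_integral_Im[OF this]
  have "((\<lambda>t. Re (h (cis t))) has_integral 2 * pi) {0..2*pi}"
    by simp
  moreover have "Re (h (cis t)) = (1 - (norm z)\<^sup>2) / (norm (1 - z * cis (- t)))\<^sup>2" for t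
  proof -
    define w where "w = cnj z * cis t"
    have w: "norm w = norm z" "norm (1 - z * cis (- t)) = norm (1 - w)"
      using complex_mod_cnj[of "1 - w"] by (simp_all add: w_def norm_mult cis_cnj)
    have "1 - w \<noteq> 0" using nz[of "cis t"] by (simp add: w_def)
    then have "h (cis t) = (1 + w) * cnj (1 - w) / of_real ((norm (1 - w))\<^sup>2)"
      by (simp add: h_def w_def[symmetric] complex_norm_square divide_simps del: of_real_power)
    then have "Re (h (cis t)) = Re ((1 + w) * cnj (1 - w)) / (norm (1 - w))\<^sup>2"
      by (simp only: Re_divide_of_real)
    also have "Re ((1 + w) * cnj (1 - w)) = 1 - (norm w)\<^sup>2"
      unfolding cmod_power2 by (simp add: algebra_simps power2_eq_square)
    finally show ?thesis by (simp add: w)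
  qed
  ultimately show ?thesis by simp
qed

lemma powr_le_one_plus_inverse:
  fixes t :: real
  assumes "t > 0" "-1 \<le> s" "s \<le> 0"
  shows "t powr s \<le> 1 / t + 1"
proof (cases "t \<le> 1")
  case True
  then have "t powr s \<le> t powr -1" using assms by (intro powr_mono') auto
  then show ?thesis using assms by (simp add: powr_minus divide_simps)
next
  case False
  then have "t powr s \<le> t powr 0" using assms by (intro powr_mono) auto
  then show ?thesis using assms by (simp add: add_increasing)
qed

text \<open>
  With \<open>d = 1 - (norm w)\<^sup>2\<close> and \<open>t = (norm (1 - w))\<^sup>2 / d\<close>, the norm of the kernel is exactly
  \<open>d powr (\<alpha> / 2) * t powr (- \<alpha> / 2 - 1)\<close>. The exponent of \<open>t\<close> lies in \<open>[-1, 0]\<close>, so that power is at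
  most \<open>1 / t + 1\<close>, and \<open>1 / t\<close> is the classical Poisson kernel.
\<close>
lemma norm_kernel_le:
  assumes \<alpha>: "-2 \<le> \<alpha>" "\<alpha> \<le> 0" and w: "norm w < 1"
  shows "norm (alpha_poisson_kernel \<alpha> w) \<le>
    (1 - (norm w)\<^sup>2) powr (\<alpha> / 2) * ((1 - (norm w)\<^sup>2) / (norm (1 - w))\<^sup>2 + 1)"
proof -
  define d y where "d = 1 - (norm w)\<^sup>2" and "y = norm (1 - w)"
  have d: "d > 0" using disk_radial_pos[OF w] by (simp add: d_def)
  have y: "y > 0" using w by (auto simp: y_def)
  have y': "norm (1 - cnj w) = y" using complex_mod_cnj[of "1 - w"] by (simp add: y_def)
  have "norm (alpha_poisson_kernel \<alpha> w) = d powr (\<alpha> + 1) / (y * y powr (\<alpha> + 1))"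
    using d unfolding alpha_poisson_kernel_def
    by (simp add: norm_divide norm_mult norm_powr_real_powr' y' y_def[symmetric] d_def[symmetric] del: of_real_add)
  also have "\<dots> = d powr (\<alpha> / 2) * (y\<^sup>2 / d) powr (- \<alpha> / 2 - 1)"
  proof -
    have "ln (d powr (\<alpha> + 1) / (y * y powr (\<alpha> + 1))) = ln (d powr (\<alpha> / 2) * (y\<^sup>2 / d) powr (- \<alpha> / 2 - 1))"
      using d y by (simp add: ln_mult ln_div ln_powr ln_realpow algebra_simps)
    then show ?thesis using d y by (subst (asm) ln_inj_iff) auto
  qed
  also have "\<dots> \<le> d powr (\<alpha> / 2) * (1 / (y\<^sup>2 / d) + 1)"
    using \<alpha> d y by (intro mult_left_mono powr_le_one_plus_inverse) auto
  finally show ?thesis by (simp add: d_def y_def)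
qed

text \<open>
  Integrating the pointwise bound, with mean \<open>1\<close> for the classical Poisson kernel. What is needed
  later is that the exponent \<open>\<alpha> / 2\<close> is strictly larger than \<open>\<alpha>\<close> when \<open>\<alpha> < 0\<close>; bounding
  \<open>norm (1 - w) powr - \<alpha>\<close> by a constant would only give the exponent \<open>\<alpha>\<close>, which is not enough.
\<close>
lemma norm_alpha_poisson_le:
  fixes F :: "complex \<Rightarrow> complex"
  assumes \<alpha>: "-2 \<le> \<alpha>" "\<alpha> \<le> 0" and z: "norm z < 1"
    and F: "continuous_on {0..2*pi} (\<lambda>t. F (cis t))"
    and M: "\<And>t. t \<in> {0..2*pi} \<Longrightarrow> norm (F (cis t)) \<le> M"
  shows "norm (alpha_poisson \<alpha> F z) \<le> 2 * M * (1 - (norm z)\<^sup>2) powr (\<alpha> / 2)"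
proof -
  define d where "d = 1 - (norm z)\<^sup>2"
  have 1: "((\<lambda>t. d powr (\<alpha> / 2) * (d / (norm (1 - z * cis (- t)))\<^sup>2 + 1) * (M / (2 * pi)))
     has_integral (d powr (\<alpha> / 2) * (2 * pi + 2 * pi) * (M / (2 * pi)))) {0..2*pi}"
    using has_integral_const_real[of "1::real" 0 "2*pi"] unfolding d_def
    by (intro has_integral_mult_left has_integral_mult_right has_integral_add poisson_kernel_has_integral[OF z]) auto
  have "norm (alpha_poisson \<alpha> F z) \<le> d powr (\<alpha> / 2) * (2 * pi + 2 * pi) * (M / (2 * pi))"
    unfolding alpha_poisson_eq_integral(2)[OF F z]
  proof (rule integral_norm_bound_integral[THEN order_trans, OF _ _ _ eq_refl[OF integral_unique[OF 1]]])
    show "(\<lambda>t. alpha_poisson_kernel \<alpha> (z * cis (- t)) * (F (cis t) / (2 * pi))) integrable_on {0..2*pi}"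
      by (intro integrable_continuous_real alpha_poisson_eq_integral(1) F z)
  next
    fix t assume t: "t \<in> {0..2*pi}"
    have "norm (alpha_poisson_kernel \<alpha> (z * cis (- t))) \<le> d powr (\<alpha> / 2) * (d / (norm (1 - z * cis (- t)))\<^sup>2 + 1)"
      using norm_kernel_le[OF \<alpha>, of "z * cis (- t)"] z by (simp add: norm_mult d_def)
    moreover have "norm (F (cis t) / (2 * pi)) \<le> M / (2 * pi)"
      using M[OF t] by (simp add: norm_divide divide_right_mono)
    ultimately show "norm (alpha_poisson_kernel \<alpha> (z * cis (- t)) * (F (cis t) / (2 * pi)))
        \<le> d powr (\<alpha> / 2) * (d / (norm (1 - z * cis (- t)))\<^sup>2 + 1) * (M / (2 * pi))"
      using disk_radial_pos[OF z] by (simp only: norm_mult) (intro mult_mono, auto simp: d_def)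
  qed (use 1 in blast)
  then show ?thesis by (simp add: d_def field_simps)
qed

section \<open>Hardy norms bound Fourier coefficients\<close>

text \<open>
  Membership in the space enters the proof only through this bound. For finite exponent \<open>q \<ge> 1\<close>
  the inequality \<open>y \<le> 1 + y powr q\<close> takes the place of Hoelder's inequality. Integrability of the
  product is a premise, since the powers of the norm say nothing about the measurability of \<open>h\<close>
  itself on a circle.
\<close>
lemma gen_hardy_circle_integral_bounded:
  assumes h: "h \<in> gen_hardy p" and p: "1 \<le> p"
  obtains C where "\<And>r e. r \<in> {0<..<1} \<Longrightarrow> (\<And>\<theta>. norm (e \<theta>) \<le> 1) \<Longrightarrow>
     (\<lambda>\<theta>. e \<theta> * h (of_real r * cis \<theta>)) integrable_on {0..2*pi} \<Longrightarrow>
     norm (integral {0..2*pi} (\<lambda>\<theta>. e \<theta> * h (of_real r * cis \<theta>))) \<le> C"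
proof (cases "p = \<infinity>")
  case True
  then have "bdd_above ((\<lambda>z. norm (h z)) ` ball 0 1)"
    using h by (simp add: gen_hardy_def)
  then obtain B where B: "\<forall>z\<in>ball 0 1. norm (h z) \<le> B"
    by (auto simp: bdd_above_def)
  show ?thesis
  proof (rule that)
    fix r e assume r: "r \<in> {0<..<1::real}" and e: "\<And>\<theta>. norm (e \<theta>) \<le> 1"
      and int: "(\<lambda>\<theta>. e \<theta> * h (of_real r * cis \<theta>)) integrable_on {0..2*pi}"
    have "norm (integral {0..2*pi} (\<lambda>\<theta>. e \<theta> * h (of_real r * cis \<theta>))) \<le> integral {0..2*pi} (\<lambda>\<theta>. B)"
    proof (rule integral_norm_bound_integral[OF int])
      fix \<theta> assume "\<theta> \<in> {0..2*pi}"
      show "norm (e \<theta> * h (of_real r * cis \<theta>)) \<le> B"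
        using mult_mono[OF e[of \<theta>] B[THEN bspec, of "of_real r * cis \<theta>"]] r by (simp add: norm_mult)
    qed auto
    then show "norm (integral {0..2*pi} (\<lambda>\<theta>. e \<theta> * h (of_real r * cis \<theta>))) \<le> 2 * pi * B"
      by simp
  qed
next
  case False
  define q where "q = enn2real p"
  have q: "1 \<le> q"
    using p False enn2real_mono[of 1 p] by (simp add: q_def top.not_eq_extremum)
  have "bdd_above ((\<lambda>r. hardy_mean q r h) ` {0<..<1})"
    using h False by (simp add: gen_hardy_def q_def)
  then obtain B where B: "\<forall>r\<in>{0<..<1}. hardy_mean q r h \<le> B"
    by (auto simp: bdd_above_def)
  have int: "integrable (lebesgue_on {0..2*pi}) (\<lambda>\<theta>. norm (h (of_real r * cis \<theta>)) powr q)"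
    if "r \<in> {0<..<1}" for r
    using h False that unfolding gen_hardy_def q_def by auto
  show ?thesis
  proof (rule that)
    fix r e assume r: "r \<in> {0<..<1::real}" and e: "\<And>\<theta>. norm (e \<theta>) \<le> 1"
      and ieh: "(\<lambda>\<theta>. e \<theta> * h (of_real r * cis \<theta>)) integrable_on {0..2*pi}"
    define I where "I = integral {0..2*pi} (\<lambda>\<theta>. norm (h (of_real r * cis \<theta>)) powr q)"
    have intq: "(\<lambda>\<theta>. norm (h (of_real r * cis \<theta>)) powr q) integrable_on {0..2*pi}"
      using int[OF r] by (intro integrable_on_lebesgue_on) auto
    have I0: "0 \<le> I" unfolding I_def by (intro integral_nonneg intq) auto
    have "(1 / (2 * pi) * I) powr (1 / q) \<le> B"
      using B[THEN bspec, OF r] lebesgue_integral_eq_integral[OF int[OF r]] by (simp add: hardy_mean_def I_def)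
    then have "((1 / (2 * pi) * I) powr (1 / q)) powr q \<le> B powr q"
      using q by (intro powr_mono2) auto
    then have I: "I \<le> 2 * pi * B powr q"
      using q I0 by (simp add: powr_powr field_simps)
    have "norm (integral {0..2*pi} (\<lambda>\<theta>. e \<theta> * h (of_real r * cis \<theta>)))
      \<le> integral {0..2*pi} (\<lambda>\<theta>. 1 + norm (h (of_real r * cis \<theta>)) powr q)"
    proof (rule integral_norm_bound_integral[OF ieh])
      show "(\<lambda>\<theta>. 1 + norm (h (of_real r * cis \<theta>)) powr q) integrable_on {0..2*pi}"
        by (intro integrable_add intq) auto
    next
      fix \<theta> :: real
      have *: "y \<le> 1 + y powr q" if "0 \<le> y" for y :: real
        using that q powr_mono[of 1 q y] by (cases "y \<le> 1") (auto simp: add_increasing2)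
      show "norm (e \<theta> * h (of_real r * cis \<theta>)) \<le> 1 + norm (h (of_real r * cis \<theta>)) powr q"
        using mult_mono[OF e[of \<theta>] *[of "norm (h (of_real r * cis \<theta>))"]] by (simp add: norm_mult)
    qed
    also have "\<dots> = 2 * pi + I"
      unfolding I_def by (subst integral_add) (use intq in auto)
    finally show "norm (integral {0..2*pi} (\<lambda>\<theta>. e \<theta> * h (of_real r * cis \<theta>))) \<le> 2 * pi + 2 * pi * B powr q"
      using I by simp
  qed
qed

section \<open>Vanishing of the antianalytic part\<close>

text \<open>
  Multiply by \<open>(1 - r\<^sup>2) powr - \<alpha>\<close> and let \<open>r\<close> tend to \<open>1\<close>: both terms on the right then carry a
  positive power of \<open>1 - r\<^sup>2\<close>.
\<close>
lemma coefficient_eq_0_if_small_growth: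
  fixes c C1 C2 \<alpha> :: real
  assumes "\<alpha> < 0" "0 \<le> c"
    and le: "\<And>r. r \<in> {0<..<1} \<Longrightarrow> r ^ m * c * (1 - r\<^sup>2) powr \<alpha> \<le> C1 + C2 * (1 - r\<^sup>2) powr (\<alpha> / 2)"
  shows "c = 0"
proof -
  have "((\<lambda>r::real. 1 - r\<^sup>2) \<longlongrightarrow> 1 - 1\<^sup>2) (at_left 1)"
    by (intro tendsto_intros)
  then have d: "((\<lambda>r::real. 1 - r\<^sup>2) \<longlongrightarrow> 0) (at_left 1)" by simp
  have ev: "\<forall>\<^sub>F r in at_left 1. r \<in> {0<..<1::real}"
    using eventually_at_left_real[of 0 "1::real"] by simp
  have pos: "1 - r\<^sup>2 > 0" if "r \<in> {0<..<1}" for r :: real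
    using that by (simp add: power_less_one_iff)
  have "((\<lambda>r. C1 * (1 - r\<^sup>2) powr (- \<alpha>) + C2 * (1 - r\<^sup>2) powr (- \<alpha> / 2)) \<longlongrightarrow> C1 * 0 powr (- \<alpha>) + C2 * 0 powr (- \<alpha> / 2)) (at_left 1)"
    using \<open>\<alpha> < 0\<close> 
    by (intro tendsto_intros tendsto_powr' d) (auto intro!: eventually_mono[OF ev] simp: power_le_one)
  then have "((\<lambda>r. C1 * (1 - r\<^sup>2) powr (- \<alpha>) + C2 * (1 - r\<^sup>2) powr (- \<alpha> / 2)) \<longlongrightarrow> 0) (at_left 1)"
    by simp
  moreover have "((\<lambda>r. r ^ m * c) \<longlongrightarrow> 1 ^ m * c) (at_left 1)"
    by (intro tendsto_intros)
  moreover have "\<forall>\<^sub>F r in at_left 1. r ^ m * c \<le> C1 * (1 - r\<^sup>2) powr (- \<alpha>) + C2 * (1 - r\<^sup>2) powr (- \<alpha> / 2)"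
    using ev
  proof eventually_elim
    case (elim r)
    have "r ^ m * c = r ^ m * c * (1 - r\<^sup>2) powr \<alpha> * (1 - r\<^sup>2) powr - \<alpha>"
      using pos[OF elim] by (simp add: mult.assoc flip: powr_add)
    also have "\<dots> \<le> (C1 + C2 * (1 - r\<^sup>2) powr (\<alpha> / 2)) * (1 - r\<^sup>2) powr - \<alpha>"
      by (intro mult_right_mono le elim) auto
    also have "\<dots> = C1 * (1 - r\<^sup>2) powr - \<alpha> + C2 * ((1 - r\<^sup>2) powr (\<alpha> / 2) * (1 - r\<^sup>2) powr - \<alpha>)"
      by (simp add: algebra_simps)
    also have "(1 - r\<^sup>2) powr (\<alpha> / 2) * (1 - r\<^sup>2) powr - \<alpha> = (1 - r\<^sup>2) powr (- \<alpha> / 2)"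
      by (simp flip: powr_add)
    finally show ?case .
  qed
  ultimately have "1 ^ m * c \<le> 0"
    using tendsto_le[OF trivial_limit_at_left_real] by blast
  then show ?thesis using \<open>0 \<le> c\<close> by simp
qed

text \<open>
  The integral is \<open>2 * pi * r ^ n * (1 - r\<^sup>2) powr \<alpha>\<close> times the conjugate of the \<open>n\<close>-th Taylor
  coefficient of \<open>g\<close>, while the right-hand side grows more slowly than \<open>(1 - r\<^sup>2) powr \<alpha>\<close> as \<open>r\<close>
  tends to \<open>1\<close>. So every Taylor coefficient vanishes. The factor \<open>r\<close> on the left is the one with
  which integration by parts produces the coefficient.
\<close>
lemma holomorphic_eq_0_if_small_growth:
  assumes g: "g holomorphic_on ball 0 1" and z: "z \<in> ball 0 1"
    and \<alpha>: "\<alpha> < 0"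
    and le: "\<And>n. \<exists>C1 C2. \<forall>r\<in>{0<..<1}. 
      r * norm (integral {0..2*pi} (\<lambda>\<theta>. cis (real n * \<theta>) * (of_real ((1 - r\<^sup>2) powr \<alpha>) * cnj (g (of_real r * cis \<theta>)))))
      \<le> C1 + C2 * (1 - r\<^sup>2) powr (\<alpha> / 2)"
  shows "g z = 0"
proof (rule holomorphic_fun_eq_0_on_ball[OF g z])
  fix n
  define c where "c = (deriv ^^ n) g 0 / fact n"
  obtain C1 C2 where C: "\<And>r. r \<in> {0<..<1} \<Longrightarrow> 
      r * norm (integral {0..2*pi} (\<lambda>\<theta>. cis (real n * \<theta>) * (of_real ((1 - r\<^sup>2) powr \<alpha>) * cnj (g (of_real r * cis \<theta>)))))
      \<le> C1 + C2 * (1 - r\<^sup>2) powr (\<alpha> / 2)"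
    using le[of n] by blast
  have "2 * pi * norm c = 0"
  proof (rule coefficient_eq_0_if_small_growth[OF \<alpha>, where m = "Suc n"])
    fix r :: real assume r: "r \<in> {0<..<1}"
    have "integral {0..2*pi} (\<lambda>\<theta>. cis (real n * \<theta>) * (of_real ((1 - r\<^sup>2) powr \<alpha>) * cnj (g (of_real r * cis \<theta>))))
      = integral {0..2*pi} (\<lambda>\<theta>. of_real ((1 - r\<^sup>2) powr \<alpha>) * cnj (cis (- (real n * \<theta>)) * g (of_real r * cis \<theta>)))"
      by (simp add: cis_cnj mult_ac)
    also have "\<dots> = of_real ((1 - r\<^sup>2) powr \<alpha>) * cnj (2 * pi * of_real r ^ n * c)"
      unfolding integral_mult_right integral_cnj[symmetric]
      using integral_unique[OF holomorphic_circle_coefficient[OF g r, of n]] by (simp only: c_def)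
    finally show "r ^ Suc n * (2 * pi * norm c) * (1 - r\<^sup>2) powr \<alpha> \<le> C1 + C2 * (1 - r\<^sup>2) powr (\<alpha> / 2)"
      using C[OF r] r by (simp add: norm_mult norm_power mult_ac)
  qed auto
  then show "(deriv ^^ n) g 0 = 0" by (simp add: c_def)
qed

section \<open>The two directions of the equivalence\<close>

lemma analytic_imp_wirtinger_bar_gen_hardy:
  assumes f: "f analytic_on ball 0 1"
  shows "wirtinger_bar f \<in> gen_hardy p"
proof -
  have 0: "wirtinger_bar f z = 0" if "norm z < 1" for z
  proof (rule wirtinger_bar_eqI)
    show "has_wirtinger f (deriv f z) 0 z"
      unfolding has_wirtinger_bar_zero_iff
      using that f
      by (metis DERIV_deriv_iff_field_differentiable analytic_on_imp_differentiable_at mem_ball_0)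
  qed
  have "wirtinger_bar f \<in> borel_measurable (lebesgue_on (ball 0 1)) \<longleftrightarrow>
     (\<lambda>_ :: complex. 0 :: complex) \<in> borel_measurable (lebesgue_on (ball 0 1))"
    by (rule measurable_cong) (auto simp: 0)
  moreover have "hardy_mean q r (wirtinger_bar f) = 0" if "r \<in> {0<..<1}" for q r
    using that by (simp add: hardy_mean_def 0 norm_mult)
  ultimately show ?thesis
    by (auto simp: gen_hardy_def 0 norm_mult bdd_above_def)
qed

theorem theorem2p3:
  fixes \<alpha> :: real and p :: ennreal and F f :: "complex \<Rightarrow> complex"
  assumes "\<alpha> \<in> {-1<..<0}"
    and "1 \<le> p"
    and "abs_continuous_circle F"
    and "circle_deriv F \<in> Lp_circle p"
    and "\<And>z. z \<in> ball 0 1 \<Longrightarrow> f z = alpha_poisson \<alpha> F z"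
  shows "(wirtinger_bar f \<in> gen_hardy p \<or> wirtinger f \<in> gen_hardy p) \<longleftrightarrow>
         f analytic_on ball 0 1"
proof
  assume "f analytic_on ball 0 1"
  then show "wirtinger_bar f \<in> gen_hardy p \<or> wirtinger f \<in> gen_hardy p"
    by (simp add: analytic_imp_wirtinger_bar_gen_hardy)
next
  assume hardy: "wirtinger_bar f \<in> gen_hardy p \<or> wirtinger f \<in> gen_hardy p"
  have F: "continuous_on {0..2*pi} (\<lambda>t. F (cis t))"
    using assms(3) by (simp add: abs_continuous_circle_def abs_continuous_on_imp_continuous_on)
  define g where "g = poisson_antianalytic_part \<alpha> F"
  have g: "g holomorphic_on ball 0 1"
    unfolding g_def by (rule poisson_antianalytic_part_holomorphic[OF F])
  define a where "a z = integral {0..2*pi}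
      (\<lambda>t. kernel_dz \<alpha> (z * cis (- t)) * cis (- t) * (F (cis t) / (2 * pi)))" for z
  define b where "b z = of_real ((1 - (norm z)\<^sup>2) powr \<alpha>) * cnj (g z)" for z
  have f: "has_wirtinger f (a z) (b z) z" if z: "norm z < 1" for z
  proof -
    have "has_wirtinger (alpha_poisson \<alpha> F) (a z) (b z) z"
      using has_wirtinger_alpha_poisson[OF F z, of \<alpha>]
      unfolding integral_kernel_dzbar[OF z] a_def b_def g_def .
    then show ?thesis
      unfolding has_wirtinger_def
      by (rule has_derivative_transform_within_open[of _ _ _ _ "ball 0 1"]) (use z assms(5) in auto)
  qed
  have wz: "wirtinger f z = a z" "wirtinger_bar f z = b z" if "norm z < 1" for z
    using f[OF that] by (auto intro: wirtinger_eqI wirtinger_bar_eqI)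
  have circ: "norm (of_real r * cis \<theta>) < 1" if "r \<in> {0<..<1}" for r \<theta>
    using that by (simp add: norm_mult)
  have ib: "(\<lambda>\<theta>. cis (real n * \<theta>) * b (of_real r * cis \<theta>)) integrable_on {0..2*pi}"
    if r: "r \<in> {0<..<1}" for r n
  proof -
    have "continuous_on {0..2*pi} (\<lambda>\<theta>. g (of_real r * cis \<theta>))"
      by (rule continuous_on_compose2[OF holomorphic_on_imp_continuous_on[OF g]])
         (use circ[OF r] in \<open>auto intro!: continuous_intros\<close>)
    then show ?thesis
      unfolding b_def norm_mult norm_cis norm_of_real
      by (intro integrable_continuous_real continuous_intros)
  qed
  have "g z = 0" if "z \<in> ball 0 1" for z
  proof (rule holomorphic_eq_0_if_small_growth[OF g that])
    fix n
    have eq: "cis (real n * \<theta>) * (of_real ((1 - r\<^sup>2) powr \<alpha>) * cnj (g (of_real r * cis \<theta>)))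
       = cis (real n * \<theta>) * b (of_real r * cis \<theta>)" for r \<theta>
      by (simp add: b_def norm_mult)
    show "\<exists>C1 C2. \<forall>r\<in>{0<..<1}. 
      r * norm (integral {0..2*pi} (\<lambda>\<theta>. cis (real n * \<theta>) * (of_real ((1 - r\<^sup>2) powr \<alpha>) * cnj (g (of_real r * cis \<theta>)))))
      \<le> C1 + C2 * (1 - r\<^sup>2) powr (\<alpha> / 2)"
      using hardy
    proof
      assume "wirtinger_bar f \<in> gen_hardy p"
      from gen_hardy_circle_integral_bounded[OF this assms(2)] obtain C where
        C: "\<And>r e. r \<in> {0<..<1} \<Longrightarrow> (\<And>\<theta>. norm (e \<theta>) \<le> 1) \<Longrightarrow>
         (\<lambda>\<theta>. e \<theta> * wirtinger_bar f (of_real r * cis \<theta>)) integrable_on {0..2*pi} \<Longrightarrow>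
         norm (integral {0..2*pi} (\<lambda>\<theta>. e \<theta> * wirtinger_bar f (of_real r * cis \<theta>))) \<le> C"
        by blast
      have "r * norm (integral {0..2*pi} (\<lambda>\<theta>. cis (real n * \<theta>) * b (of_real r * cis \<theta>))) \<le> C + 0 * (1 - r\<^sup>2) powr (\<alpha> / 2)"
        if r: "r \<in> {0<..<1}" for r
      proof -
        have "norm (integral {0..2*pi} (\<lambda>\<theta>. cis (real n * \<theta>) * b (of_real r * cis \<theta>))) \<le> C"
          using C[OF r, of "\<lambda>\<theta>. cis (real n * \<theta>)"] ib[OF r, of n] by (simp add: wz circ[OF r])
        moreover have "r * x \<le> x" if "0 \<le> x" for x
          using that r by (simp add: mult_left_le_one_le)
        ultimately show ?thesis by (smt (verit, best) norm_ge_zero mult_zero_left)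
      qed
      then show ?thesis unfolding eq by blast
    next
      assume "wirtinger f \<in> gen_hardy p"
      from gen_hardy_circle_integral_bounded[OF this assms(2)] obtain C where
        C: "\<And>r e. r \<in> {0<..<1} \<Longrightarrow> (\<And>\<theta>. norm (e \<theta>) \<le> 1) \<Longrightarrow>
         (\<lambda>\<theta>. e \<theta> * wirtinger f (of_real r * cis \<theta>)) integrable_on {0..2*pi} \<Longrightarrow>
         norm (integral {0..2*pi} (\<lambda>\<theta>. e \<theta> * wirtinger f (of_real r * cis \<theta>))) \<le> C"
        by blast
      obtain M where "\<forall>t\<in>{0..2*pi}. norm (F (cis t)) \<le> M"
        using compact_imp_bounded[OF compact_continuous_image[OF F]] by (auto simp: bounded_iff)
      then have M: "norm (F (cis t)) \<le> M" if "t \<in> {0..2*pi}" for t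
        using that by blast
      define k where "k = Suc n"
      have "r * norm (integral {0..2*pi} (\<lambda>\<theta>. cis (real n * \<theta>) * b (of_real r * cis \<theta>)))
          \<le> C + (real k * (2 * pi * (2 * M))) * (1 - r\<^sup>2) powr (\<alpha> / 2)"
        if r: "r \<in> {0<..<1}" for r
      proof -
        let ?z = "\<lambda>\<theta>. of_real r * cis \<theta>"
        define A B J where "A = integral {0..2*pi} (\<lambda>\<theta>. cis (real (k + 1) * \<theta>) * a (?z \<theta>))"
          and "B = integral {0..2*pi} (\<lambda>\<theta>. cis (real n * \<theta>) * b (?z \<theta>))"
          and "J = integral {0..2*pi} (\<lambda>\<theta>. cis (real k * \<theta>) * f (?z \<theta>))"
        (* The frequency k = n + 1 is chosen so that its product with cnj z, which contributes
           cis (- \<theta>), is the n-th frequency in front of b. *)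
        have 1: "((\<lambda>\<theta>. cis (real k * \<theta>) * (of_real r * cis \<theta> * a (?z \<theta>) - of_real r * cis (- \<theta>) * b (?z \<theta>)))
            has_integral - (real k * J)) {0..2*pi}"
          unfolding J_def by (rule has_wirtinger_circle_by_parts) (rule f[OF circ[OF r]])
        have 2: "((\<lambda>\<theta>. cis (real n * \<theta>) * b (?z \<theta>)) has_integral B) {0..2*pi}"
          unfolding B_def by (rule integrable_integral[OF ib[OF r]])
        have cis_k: "cis (real k * \<theta>) * cis \<theta> = cis (real (k + 1) * \<theta>)"
          "cis (real k * \<theta>) * cis (- \<theta>) = cis (real n * \<theta>)" for \<theta>
          by (simp_all add: cis_mult k_def algebra_simps)
        have "((\<lambda>\<theta>. cis (real (k + 1) * \<theta>) * a (?z \<theta>)) has_integral (- (real k * J) / r + B)) {0..2*pi}"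
        proof (rule has_integral_eq[OF _ has_integral_add[OF has_integral_divide[OF 1] 2]])
          fix \<theta>
          show "cis (real k * \<theta>) * (of_real r * cis \<theta> * a (?z \<theta>) - of_real r * cis (- \<theta>) * b (?z \<theta>)) / of_real r
              + cis (real n * \<theta>) * b (?z \<theta>) = cis (real (k + 1) * \<theta>) * a (?z \<theta>)"
            unfolding cis_k[symmetric] using r by (simp add: field_simps)
        qed
        then have 3: "A = - (real k * J) / r + B" 
          and iA: "(\<lambda>\<theta>. cis (real (k + 1) * \<theta>) * a (?z \<theta>)) integrable_on {0..2*pi}"
          unfolding A_def by (auto dest: integral_unique)
        have nA: "norm A \<le> C"
          using C[OF r, of "\<lambda>\<theta>. cis (real (k + 1) * \<theta>)"] iA unfolding A_def by (simp add: wz circ[OF r])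
        have nJ: "norm J \<le> 2 * M * (1 - r\<^sup>2) powr (\<alpha> / 2) * (2 * pi - 0)"
          unfolding J_def
        proof (rule integral_bound)
          have "continuous_on (ball 0 1) f"
            using f by (auto intro!: continuous_at_imp_continuous_on has_derivative_continuous simp: has_wirtinger_def)
          then have "continuous_on {0..2*pi} (\<lambda>\<theta>. f (?z \<theta>))"
            by (rule continuous_on_compose2) (use circ[OF r] in \<open>auto intro!: continuous_intros\<close>)
          then show "continuous_on {0..2*pi} (\<lambda>\<theta>. cis (real k * \<theta>) * f (?z \<theta>))"
            by (intro continuous_intros)
        next
          fix \<theta>
          show "norm (cis (real k * \<theta>) * f (?z \<theta>)) \<le> 2 * M * (1 - r\<^sup>2) powr (\<alpha> / 2)"
            using norm_alpha_poisson_le[OF _ _ circ[OF r] F M, of \<alpha> \<theta>] circ[OF r, of \<theta>] assms(1,5)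
            by (simp add: norm_mult)
        qed auto
        (* Here the Hardy bound controls A, the growth bound for f controls J, and B inherits
           the slower growth. *)
        have "of_real r * B = of_real r * A + real k * J"
          using r 3 by (simp add: field_simps)
        then have "r * norm B = norm (of_real r * A + real k * J)"
          using r by (metis abs_of_pos greaterThanLessThan_iff norm_mult norm_of_real)
        also have "\<dots> \<le> r * norm A + real k * norm J"
          using norm_triangle_ineq[of "of_real r * A" "real k * J"] r by (simp add: norm_mult)
        also have "r * norm A \<le> norm A"
          using r by (simp add: mult_left_le_one_le)
        also note nA
        also have "real k * norm J \<le> real k * (2 * M * (1 - r\<^sup>2) powr (\<alpha> / 2) * (2 * pi - 0))"
          by (intro mult_left_mono nJ) auto
        finally show ?thesis
          unfolding B_def by (simp add: mult_ac)
      qed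
      then show ?thesis unfolding eq by blast
    qed
  qed (use assms(1) in auto)
  then have "(f has_field_derivative a z) (at z)" if "z \<in> ball 0 1" for z
    using f[of z] that by (simp add: b_def has_wirtinger_bar_zero_iff)
  then have "f holomorphic_on ball 0 1"
    unfolding holomorphic_on_open[OF open_ball] by blast
  then show "f analytic_on ball 0 1"
    by (simp add: analytic_on_open)
qed

end
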